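(* If $H$ is a forest (equivalently, a graph of degeneracy $1$), then $g(H,k)=\infty$ for all sufficiently large $k$.
   Context: For a graph $H$, an edge colouring $c:E(K_n)\to[k]$ contains a rainbow copy of $H$ if some subgraph of $K_n$ isomorphic to $H$ has all its edges of pairwise distinct colours; otherwise it is rainbow $H$-free. The colouring has colour distribution sequence $(e_1,\dots,e_k)$ if exactly $e_i$ edges have colour $i$. $g(H,k)$ is the smallest integer $N$ such that for all $n\ge N$ and all non-negative integers $e_1,\dots,e_k$ with $\sum_i e_i=\binom n2$, there exists a rainbow $H$-free colouring of $K_n$ with colour distribution sequence $(e_1,\dots,e_k)$; if no such $N$ exists, $g(H,k)=\infty$. A graph is $d$-degenerate if every subgraph has a vertex of degree at most $d$; the degeneracy is the smallest positive $d$ for which it is $d$-degenerate. *)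

theory Defs
  imports "HOL-Library.Ramsey" "HOL-Library.FuncSet" "HOL-Library.Extended_Nat"
begin

record 'a graph =
  verts :: "'a set"
  edges :: "'a set set"

definition simple_graph :: "'a graph \<Rightarrow> bool" where
  "simple_graph G \<longleftrightarrow> edges G \<subseteq> [verts G]\<^bsup>2\<^esup>"

definition finite_graph :: "'a graph \<Rightarrow> bool" where
  "finite_graph G \<longleftrightarrow> simple_graph G \<and> finite (verts G)"

definition subgraph :: "'a graph \<Rightarrow> 'a graph \<Rightarrow> bool" where
  "subgraph G' G \<longleftrightarrow> simple_graph G' \<and> verts G' \<subseteq> verts G \<and> edges G' \<subseteq> edges G"

definition isomorphic :: "'a graph \<Rightarrow> 'b graph \<Rightarrow> bool" where
  "isomorphic G H \<longleftrightarrow> (\<exists>f. bij_betw f (verts G) (verts H) \<and>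
     (\<forall>u\<in>verts G. \<forall>v\<in>verts G. {u, v} \<in> edges G \<longleftrightarrow> {f u, f v} \<in> edges H))"

definition degree :: "'a graph \<Rightarrow> 'a \<Rightarrow> nat" where
  "degree G v = card {e \<in> edges G. v \<in> e}"

text \<open>A cycle is given by the list of its vertices, in cyclic order and without repeating the
  first vertex at the end.\<close>

definition is_cycle :: "'a graph \<Rightarrow> 'a list \<Rightarrow> bool" where
  "is_cycle G p \<longleftrightarrow> length p \<ge> 3 \<and> distinct p \<and> set p \<subseteq> verts G \<and>
     (\<forall>i<length p. {p ! i, p ! (Suc i mod length p)} \<in> edges G)"

definition forest :: "'a graph \<Rightarrow> bool" where
  "forest G \<longleftrightarrow> (\<nexists>p. is_cycle G p)"

definition degenerate :: "nat \<Rightarrow> 'a graph \<Rightarrow> bool" where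
  "degenerate d G \<longleftrightarrow>
     (\<forall>G'. subgraph G' G \<and> verts G' \<noteq> {} \<longrightarrow> (\<exists>v\<in>verts G'. degree G' v \<le> d))"

definition degeneracy :: "'a graph \<Rightarrow> nat" where
  "degeneracy G = (LEAST d. d > 0 \<and> degenerate d G)"

definition complete_graph :: "nat \<Rightarrow> nat graph" where
  "complete_graph n = \<lparr>verts = {1..n}, edges = [{1..n}]\<^bsup>2\<^esup>\<rparr>"

definition edge_colouring :: "nat \<Rightarrow> nat \<Rightarrow> (nat set \<Rightarrow> nat) \<Rightarrow> bool" where
  "edge_colouring n k c \<longleftrightarrow> c \<in> edges (complete_graph n) \<rightarrow> {1..k}"

definition contains_rainbow_copy :: "nat \<Rightarrow> (nat set \<Rightarrow> nat) \<Rightarrow> 'a graph \<Rightarrow> bool" where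
  "contains_rainbow_copy n c H \<longleftrightarrow>
     (\<exists>H'. subgraph H' (complete_graph n) \<and> isomorphic H H' \<and> inj_on c (edges H'))"

definition colour_distribution :: "nat \<Rightarrow> nat \<Rightarrow> (nat set \<Rightarrow> nat) \<Rightarrow> (nat \<Rightarrow> nat) \<Rightarrow> bool" where
  "colour_distribution n k c e \<longleftrightarrow>
     (\<forall>i\<in>{1..k}. card {x \<in> edges (complete_graph n). c x = i} = e i)"

definition all_distributions_from :: "'a graph \<Rightarrow> nat \<Rightarrow> nat \<Rightarrow> bool" where
  "all_distributions_from H k N \<longleftrightarrow>
     (\<forall>n\<ge>N. \<forall>e :: nat \<Rightarrow> nat. (\<Sum>i=1..k. e i) = n choose 2 \<longrightarrow>
        (\<exists>c. edge_colouring n k c \<and> colour_distribution n k c e \<and> \<not> contains_rainbow_copy n c H))"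

text \<open>The infimum in the extended naturals is a minimum if some \<open>N\<close> qualifies and is
  \<open>\<infinity>\<close> otherwise.\<close>

definition g :: "'a graph \<Rightarrow> nat \<Rightarrow> enat" where
  "g H k = Inf {enat N |N. all_distributions_from H k N}"

lemma g_eq_infinity_iff: "g H k = \<infinity> \<longleftrightarrow> (\<nexists>N. all_distributions_from H k N)"
proof -
  have "g H k \<noteq> \<infinity>" if "all_distributions_from H k N" for N
  proof -
    have "g H k \<le> enat N"
      unfolding g_def using that by (intro Inf_lower) blast
    then show ?thesis by (cases "g H k") auto
  qed
  moreover have "g H k = \<infinity>" if "\<nexists>N. all_distributions_from H k N"
    using that by (simp add: g_def Inf_enat_def)
  ultimately show ?thesis by blast
qed

lemma finite_edges:
  assumes "finite_graph G" shows "finite (edges G)"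
proof -
  have "finite ([verts G]\<^bsup>2\<^esup>)" "edges G \<subseteq> [verts G]\<^bsup>2\<^esup>"
    using assms by (auto simp: finite_graph_def simple_graph_def intro: finite_imp_finite_nsets)
  then show ?thesis using finite_subset by blast
qed

lemma finite_graph_subgraph:
  assumes "finite_graph G" "subgraph G' G" shows "finite_graph G'"
  using assms finite_subset by (auto simp: finite_graph_def subgraph_def)

lemma degenerate_one_imp_forest:
  assumes G: "finite_graph G" and d: "degenerate 1 G"
  shows "forest G"
  unfolding forest_def
proof
  assume "\<exists>p. is_cycle G p"
  then obtain p where p: "length p \<ge> 3" "distinct p" "set p \<subseteq> verts G"
    and E: "\<And>i. i < length p \<Longrightarrow> {p ! i, p ! (Suc i mod length p)} \<in> edges G"
    by (auto simp: is_cycle_def)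
  define C where "C = \<lparr>verts = set p, edges = edges G \<inter> [set p]\<^bsup>2\<^esup>\<rparr>"
  have sub: "subgraph C G" "verts C \<noteq> {}"
    using p by (auto simp: C_def subgraph_def simple_graph_def)
  then obtain v where v: "v \<in> set p" "degree C v \<le> 1"
    using d unfolding degenerate_def C_def by fastforce
  then obtain j where j: "j < length p" "v = p ! j" by (metis in_set_conv_nth)
  let ?l = "length p"
  define i where "i = (if j = 0 then ?l - 1 else j - 1)"
  define m where "m = (if Suc j = ?l then 0 else Suc j)"
  have i: "i < ?l" "Suc i mod ?l = j" and m: "m < ?l" "Suc j mod ?l = m"
    and ne: "i \<noteq> m" "i \<noteq> j" "m \<noteq> j"
    using j p(1) by (auto simp: i_def m_def)
  have "{p ! i, v} \<in> edges G" "{v, p ! m} \<in> edges G"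
    using E[OF i(1)] E[OF j(1)] i m j by auto
  moreover have "p ! i \<noteq> v" "p ! m \<noteq> v" "p ! i \<noteq> p ! m"
    using ne i m j p(2) by (auto simp: nth_eq_iff_index_eq)
  ultimately have "{{p ! i, v}, {v, p ! m}} \<subseteq> {e \<in> edges C. v \<in> e}"
    and two: "card {{p ! i, v}, {v, p ! m}} = 2"
    using i(1) m(1) v(1) by (auto simp: C_def doubleton_eq_iff card_2_iff)
  moreover have "finite {e \<in> edges C. v \<in> e}"
    using finite_edges[OF finite_graph_subgraph[OF G sub(1)]] by simp
  ultimately have "card {{p ! i, v}, {v, p ! m}} \<le> degree C v"
    unfolding degree_def by (intro card_mono)
  then have "2 \<le> degree C v" using two by linarith
  then show False using v by simp
qed

lemma forest_imp_degenerate_one: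
  assumes G: "finite_graph G" and F: "forest G"
  shows "degenerate 1 G"
  unfolding degenerate_def
proof (intro allI impI, rule ccontr)
  fix G' assume "subgraph G' G \<and> verts G' \<noteq> {}"
    and deg: "\<not> (\<exists>v\<in>verts G'. degree G' v \<le> 1)"
  then have sub: "subgraph G' G" and "verts G' \<noteq> {}" by auto
  then obtain v where v: "v \<in> verts G'" by auto
  have fin: "finite (verts G')"
    using finite_graph_subgraph[OF G sub] by (simp add: finite_graph_def)
  have edge2: "e \<in> [verts G']\<^bsup>2\<^esup>" if "e \<in> edges G'" for e
    using sub that by (auto simp: subgraph_def simple_graph_def)
  define P where "P p \<longleftrightarrow> p \<noteq> [] \<and> distinct p \<and> set p \<subseteq> verts G' \<and>
    (\<forall>i. Suc i < length p \<longrightarrow> {p ! i, p ! Suc i} \<in> edges G')" for p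
  have "P [v]" using v by (simp add: P_def)
  moreover have "\<forall>p. P p \<longrightarrow> length p < Suc (card (verts G'))"
    using fin by (auto simp: P_def less_Suc_eq_le) (metis card_mono distinct_card)
  ultimately obtain p where p: "P p" and max: "\<And>q. P q \<Longrightarrow> length q \<le> length p"
    using ex_has_greatest_nat[of P "[v]" length "Suc (card (verts G'))"] by auto
  have p0: "p ! 0 \<in> verts G'" using p by (auto simp: P_def)
  have all_in: "w \<in> set p" if w: "{p ! 0, w} \<in> edges G'" for w
  proof (rule ccontr)
    assume "w \<notin> set p"
    moreover have "w \<in> verts G'" using edge2[OF w] by simp
    moreover have "{(w # p) ! i, (w # p) ! Suc i} \<in> edges G'" if "Suc i < length (w # p)" for i
      using that p w by (cases i) (auto simp: P_def insert_commute)
    ultimately have "P (w # p)" using p by (auto simp: P_def)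
    then show False using max[of "w # p"] by simp
  qed
  have "\<exists>e\<in>edges G'. p ! 0 \<in> e \<and> e \<noteq> {p ! 0, p ! 1}"
  proof (rule ccontr)
    assume "\<not> ?thesis"
    then have "{e \<in> edges G'. p ! 0 \<in> e} \<subseteq> {{p ! 0, p ! 1}}" by auto
    then have "degree G' (p ! 0) \<le> 1"
      unfolding degree_def using card_mono[of "{{p ! 0, p ! 1}}"] by force
    then show False using deg p0 by auto
  qed
  then obtain e where e: "e \<in> edges G'" "p ! 0 \<in> e" "e \<noteq> {p ! 0, p ! 1}" by blast
  then obtain w where w: "e = {p ! 0, w}" "w \<noteq> p ! 0"
    using edge2[OF e(1)] by (auto simp: nsets_2_eq)
  then have "w \<in> set p" using all_in e by auto
  then obtain j where j: "j < length p" "w = p ! j" by (metis in_set_conv_nth)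
  have j2: "j \<ge> 2"
  proof -
    have "j \<noteq> 0" "j \<noteq> 1" using w e j by auto
    then show ?thesis by linarith
  qed
  define q where "q = take (Suc j) p"
  have len: "length q = Suc j" using j by (simp add: q_def)
  have "{q ! i, q ! (Suc i mod length q)} \<in> edges G" if i: "i < length q" for i
  proof (cases "i = j")
    case True
    then show ?thesis
      using e w j sub len by (auto simp: q_def subgraph_def insert_commute)
  next
    case False
    then have "Suc i < Suc j" using i len by simp
    then show ?thesis
      using p j sub len by (auto simp: q_def P_def subgraph_def)
  qed
  moreover have "set q \<subseteq> verts G"
    using p sub set_take_subset[of "Suc j" p] by (auto simp: q_def P_def subgraph_def)
  ultimately have "is_cycle G q"
    using j2 len p by (auto simp: is_cycle_def P_def q_def)
  then show False using F by (auto simp: forest_def)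
qed

theorem forest_iff_degeneracy_eq_one:
  assumes "finite_graph G"
  shows "forest G \<longleftrightarrow> degeneracy G = 1"
proof
  assume "forest G"
  then have "degenerate 1 G" using forest_imp_degenerate_one assms by blast
  then show "degeneracy G = 1"
    unfolding degeneracy_def by (intro Least_equality) auto
next
  assume one: "degeneracy G = 1"
  have fin: "finite (edges G)" by (rule finite_edges[OF assms])
  have "degenerate (Suc (card (edges G))) G"
    unfolding degenerate_def
  proof (intro allI impI)
    fix G' assume "subgraph G' G \<and> verts G' \<noteq> {}"
    then obtain v where "v \<in> verts G'" and "{e \<in> edges G'. v \<in> e} \<subseteq> edges G"
      by (auto simp: subgraph_def)
    then have "degree G' v \<le> Suc (card (edges G))"
      unfolding degree_def using card_mono[OF fin] le_SucI by blast
    then show "\<exists>v\<in>verts G'. degree G' v \<le> Suc (card (edges G))"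
      using \<open>v \<in> verts G'\<close> by blast
  qed
  then have "degenerate (degeneracy G) G"
    unfolding degeneracy_def
    using LeastI[of "\<lambda>d. d > 0 \<and> degenerate d G" "Suc (card (edges G))"] by blast
  then show "forest G" using degenerate_one_imp_forest assms one by simp
qed

end

theory Submission
  imports Defs Complex_Main
begin

text \<open>
  Colour \<open>K\<^sub>n\<close> with all \<open>k\<close> colours equally frequent. Put \<open>A\<^sub>0 = V(K\<^sub>n)\<close> and let \<open>A\<^sub>r\<^sub>+\<^sub>1\<close> consist of
  the vertices of \<open>A\<^sub>r\<close> that see at least \<open>M\<close> colours towards \<open>A\<^sub>r\<close>, where \<open>M\<close> exceeds
  \<open>|V(H)| + |E(H)|\<close>. If \<open>A\<^sub>h\<close> is nonempty for \<open>h = |V(H)|\<close>, then a rainbow copy of \<open>H\<close> is built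
  greedily, adding one vertex with at most one earlier neighbour at a time and descending one level
  each time. Otherwise some difference \<open>D = A\<^sub>r - A\<^sub>r\<^sub>+\<^sub>1\<close> has at least \<open>n / h\<close> vertices, and every
  vertex of \<open>D\<close> sees fewer than \<open>M\<close> colours inside \<open>D\<close>. A colour seen by \<open>p\<close> vertices of \<open>D\<close> has at
  most \<open>p\<^sup>2\<close> and at most \<open>n\<^sup>2 / (2 k)\<close> edges in \<open>D\<close>, hence at most \<open>p n / \<surd>(2 k)\<close>; summing over the
  colours, \<open>D\<close> has at most \<open>M |D| n / \<surd>(2 k)\<close> edges, which is too few when \<open>k\<close> is large.
\<close>

section \<open>Colours seen by a vertex and the peeling of the vertex set\<close>

definition seen_colours :: "('a set \<Rightarrow> 'b) \<Rightarrow> 'a set \<Rightarrow> 'a \<Rightarrow> 'b set" where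
  "seen_colours c A v = (\<lambda>w. c {v, w}) ` (A - {v})"

fun peel :: "('a set \<Rightarrow> 'b) \<Rightarrow> nat \<Rightarrow> 'a set \<Rightarrow> nat \<Rightarrow> 'a set" where
  "peel c M V 0 = V"
| "peel c M V (Suc r) = {v \<in> peel c M V r. card (seen_colours c (peel c M V r) v) \<ge> M}"

lemma peel_antimono: "r \<le> r' \<Longrightarrow> peel c M V r' \<subseteq> peel c M V r"
  by (rule lift_Suc_antimono_le[of "peel c M V"]) auto

lemma peel_subset: "peel c M V r \<subseteq> V"
  using peel_antimono[of 0 r] by simp

lemma seen_colours_mono: "A \<subseteq> B \<Longrightarrow> seen_colours c A v \<subseteq> seen_colours c B v"
  by (auto simp: seen_colours_def)

section \<open>Greedy rainbow embedding of a forest\<close>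

lemma exists_fresh_neighbour:
  assumes "finite A" "finite S" "finite U"
    and many: "card U + card S < card (seen_colours c A u)"
  shows "\<exists>w\<in>A - {u}. w \<notin> S \<and> c {u, w} \<notin> U"
proof (rule ccontr)
  assume "\<not> ?thesis"
  then have sub: "seen_colours c A u \<subseteq> U \<union> (\<lambda>w. c {u, w}) ` S"
    by (auto simp: seen_colours_def)
  have "card (seen_colours c A u) \<le> card (U \<union> (\<lambda>w. c {u, w}) ` S)"
    using assms sub by (intro card_mono) auto
  \<comment> \<open>Each excluded vertex of \<open>S\<close> accounts for at most one colour seen
    from \<open>u\<close>.\<close>
  also have "\<dots> \<le> card U + card S"
    using card_Un_le[of U "(\<lambda>w. c {u, w}) ` S"] card_image_le[OF \<open>finite S\<close>, of "\<lambda>w. c {u, w}"]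
    by linarith
  finally show False using many by simp
qed

text \<open>Degeneracy is applied to the subgraph induced on \<open>X\<close>. Stating that edges at
  \<open>v\<close> coincide covers an isolated \<open>v\<close> as well as a leaf.\<close>

lemma degenerate_one_leaf:
  assumes H: "finite_graph H" and deg: "degenerate 1 H" and X: "X \<subseteq> verts H" "X \<noteq> {}"
  obtains v where "v \<in> X"
    "\<And>e e'. \<lbrakk>e \<in> edges H; e \<subseteq> X; v \<in> e; e' \<in> edges H; e' \<subseteq> X; v \<in> e'\<rbrakk> \<Longrightarrow> e = e'"
proof -
  define G where "G = \<lparr>verts = X, edges = {e \<in> edges H. e \<subseteq> X}\<rparr>"
  have "simple_graph H" using H by (simp add: finite_graph_def)
  then have "subgraph G H"
    using X by (auto simp: G_def subgraph_def simple_graph_def nsets_def)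
  then obtain v where v: "v \<in> X" "degree G v \<le> 1"
    using deg X unfolding degenerate_def by (fastforce simp: G_def)
  have "finite {e \<in> edges G. v \<in> e}"
    using finite_edges[OF H] by (simp add: G_def)
  then have "e = e'" if "e \<in> edges G" "v \<in> e" "e' \<in> edges G" "v \<in> e'" for e e'
    using v(2) that by (auto simp: degree_def card_le_Suc0_iff_eq)
  then show thesis
    using v(1) that by (auto simp: G_def)
qed

text \<open>Induction on \<open>card X\<close>: remove a vertex \<open>v\<close> of degree at most
  one, embed the rest one level deeper in the peeling, then place \<open>v\<close>. The image of the
  neighbour of \<open>v\<close> lies in that deeper level, so it still sees \<open>M\<close> colours
  towards the level where \<open>v\<close> must go.\<close>

lemma rainbow_embedding_of_peel:
  fixes H :: "'a graph" and c :: "'b set \<Rightarrow> 'c"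
  assumes H: "finite_graph H" and deg: "degenerate 1 H"
    and V: "finite V" and M: "card (edges H) + card (verts H) < M"
    and ne: "peel c M V h \<noteq> {}" and X: "X \<subseteq> verts H" "card X \<le> h"
  shows "\<exists>f. inj_on f X \<and> f ` X \<subseteq> peel c M V (h - card X) \<and>
           inj_on (\<lambda>e. c (f ` e)) {e \<in> edges H. e \<subseteq> X}"
  using X
proof (induction "card X" arbitrary: X)
  case 0
  have "finite X" using 0 H by (auto simp: finite_graph_def intro: finite_subset)
  then have "X = {}" using 0 by simp
  moreover have "{} \<notin> edges H"
    using H by (auto simp: finite_graph_def simple_graph_def nsets_def)
  ultimately show ?case by (auto simp: inj_on_def)
next
  case (Suc m)
  have finX: "finite X" using Suc.prems H by (auto simp: finite_graph_def intro: finite_subset)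
  have "X \<noteq> {}" using Suc by auto
  then obtain v where v: "v \<in> X" and leaf:
    "\<And>e e'. \<lbrakk>e \<in> edges H; e \<subseteq> X; v \<in> e; e' \<in> edges H; e' \<subseteq> X; v \<in> e'\<rbrakk> \<Longrightarrow> e = e'"
    using degenerate_one_leaf[OF H deg Suc.prems(1)] by blast
  define Y where "Y = X - {v}"
  define E where "E = {e \<in> edges H. e \<subseteq> Y}"
  define r where "r = h - card X"
  have cY: "card Y = m" using v Suc.hyps finX by (simp add: Y_def)
  \<comment> \<open>Since \<open>card X\<close> is at most \<open>h\<close>, the truncated
    subtraction is exact, and \<open>Y\<close> sits exactly one level deeper than
    \<open>X\<close>.\<close>
  have r: "h - card Y = Suc r" using cY Suc by (simp add: r_def)
  have finE: "finite E" "E \<subseteq> edges H" using finite_edges[OF H] by (auto simp: E_def)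
  have "\<exists>f. inj_on f Y \<and> f ` Y \<subseteq> peel c M V (h - card Y) \<and>
           inj_on (\<lambda>e. c (f ` e)) {e \<in> edges H. e \<subseteq> Y}"
    using Suc.prems Suc.hyps(2) cY by (intro Suc.hyps(1)) (auto simp: Y_def)
  then obtain f where f: "inj_on f Y" "f ` Y \<subseteq> peel c M V (Suc r)" "inj_on (\<lambda>e. c (f ` e)) E"
    unfolding E_def r by blast
  \<comment> \<open>\<open>x\<close> is the image of the only neighbour of \<open>v\<close> in
    \<open>Y\<close>. If there is none, any vertex of this level serves as a dummy, and one exists
    because the level contains the nonempty \<open>peel c M V h\<close>.\<close>
  obtain x where x: "x \<in> peel c M V (Suc r)"
    "\<And>y. y \<in> Y \<Longrightarrow> {v, y} \<in> edges H \<Longrightarrow> x = f y"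
  proof (cases "\<exists>y\<in>Y. {v, y} \<in> edges H")
    case True
    then obtain y where y: "y \<in> Y" "{v, y} \<in> edges H" by blast
    have "y' = y" if "y' \<in> Y" "{v, y'} \<in> edges H" for y'
      using leaf[of "{v, y}" "{v, y'}"] that y v by (auto simp: Y_def doubleton_eq_iff)
    then show thesis using that[of "f y"] y f(2) by blast
  next
    case False
    have "peel c M V h \<subseteq> peel c M V (Suc r)"
      using r by (intro peel_antimono) auto
    then show thesis using ne that False by blast
  qed
  have "card (f ` Y) \<le> card (verts H)"
  proof -
    have "card Y \<le> card (verts H)"
      using H Suc.prems by (intro card_mono) (auto simp: Y_def finite_graph_def)
    then show ?thesis
      using card_image_le[of Y f] finX by (simp add: Y_def)
  qed
  moreover have "card ((\<lambda>e. c (f ` e)) ` E) \<le> card (edges H)"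
    using card_image_le[OF finE(1), of "\<lambda>e. c (f ` e)"] card_mono[OF finite_edges[OF H] finE(2)]
    by linarith
  \<comment> \<open>The forbidden vertices are those already used, the forbidden colours those of
    the edges already embedded; \<open>M\<close> exceeds both counts together.\<close>
  ultimately have "card ((\<lambda>e. c (f ` e)) ` E) + card (f ` Y)
      < card (seen_colours c (peel c M V r) x)"
    using M x(1) by simp
  then obtain w where w: "w \<in> peel c M V r" "w \<notin> f ` Y" "c {x, w} \<notin> (\<lambda>e. c (f ` e)) ` E"
    using exists_fresh_neighbour[of "peel c M V r" "f ` Y" "(\<lambda>e. c (f ` e)) ` E" c x]
      finX finE V peel_subset[of c M V r] by (auto simp: Y_def finite_subset)
  define f' where "f' = f(v := w)"
  have XY: "X = insert v Y" "v \<notin> Y" using v by (auto simp: Y_def)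
  have f'Y: "f' ` S = f ` S" if "S \<subseteq> Y" for S
    using XY that by (auto simp: f'_def)
  have inj: "inj_on f' X"
    using f(1) w(2) XY f'Y[of Y] by (auto simp: f'_def inj_on_fun_updI)
  have "peel c M V (Suc r) \<subseteq> peel c M V r" by (intro peel_antimono) simp
  then have range: "f' ` X \<subseteq> peel c M V r"
    using f(2) w(1) f'Y[of Y] XY by (auto simp: f'_def)
  have old: "c (f' ` e) = c (f ` e)" if "e \<in> E" for e
    using f'Y[of e] that by (simp add: E_def)
  have new: "c (f' ` e) = c {x, w}" if e: "e \<in> edges H" "e \<subseteq> X" "v \<in> e" for e
  proof -
    have "e \<in> [verts H]\<^bsup>2\<^esup>" using H e by (auto simp: finite_graph_def simple_graph_def)
    then obtain y where y: "e = {v, y}" "y \<noteq> v" using e(3) by (auto simp: nsets_2_eq)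
    then have "y \<in> Y" using e(2) XY by auto
    then have "x = f y" using x(2) y e(1) by blast
    then show ?thesis using y by (simp add: f'_def insert_commute)
  qed
  \<comment> \<open>Edges avoiding \<open>v\<close> keep their distinct colours, at most one edge
    contains \<open>v\<close>, and the colour of \<open>{x, w}\<close> is new.\<close>
  have "inj_on (\<lambda>e. c (f' ` e)) {e \<in> edges H. e \<subseteq> X}"
  proof (rule inj_onI)
    fix e e' assume e: "e \<in> {e \<in> edges H. e \<subseteq> X}" and e': "e' \<in> {e \<in> edges H. e \<subseteq> X}"
      and eq: "c (f' ` e) = c (f' ` e')"
    have inE: "d \<in> E" if "d \<in> {e \<in> edges H. e \<subseteq> X}" "v \<notin> d" for d
      using that XY by (auto simp: E_def)
    show "e = e'"
    proof (cases "v \<in> e"; cases "v \<in> e'")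
      assume "v \<in> e" "v \<in> e'"
      then show ?thesis using leaf e e' by blast
    next
      assume "v \<in> e" "v \<notin> e'"
      then have "c {x, w} = c (f ` e')" using eq new[of e] old[OF inE[OF e']] e by auto
      then show ?thesis using w(3) inE[OF e' \<open>v \<notin> e'\<close>] by blast
    next
      assume "v \<notin> e" "v \<in> e'"
      then have "c {x, w} = c (f ` e)" using eq new[of e'] old[OF inE[OF e]] e' by auto
      then show ?thesis using w(3) inE[OF e \<open>v \<notin> e\<close>] by blast
    next
      assume "v \<notin> e" "v \<notin> e'"
      then show ?thesis
        using eq old[OF inE[OF e]] old[OF inE[OF e']] inE[OF e] inE[OF e'] f(3)
        by (auto dest: inj_onD)
    qed
  qed
  then show ?case using inj range unfolding r_def by blast
qed

lemma contains_rainbow_copyI: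
  assumes H: "simple_graph H" and f: "inj_on f (verts H)" "f ` verts H \<subseteq> {1..n}"
    and rainbow: "inj_on (\<lambda>e. c (f ` e)) (edges H)"
  shows "contains_rainbow_copy n c H"
proof -
  define H' where "H' = \<lparr>verts = f ` verts H, edges = (`) f ` edges H\<rparr>"
  have edge: "e \<subseteq> verts H" "finite e" "card e = 2" if "e \<in> edges H" for e
    using H that by (auto simp: simple_graph_def nsets_def)
  have "f ` e \<in> [f ` verts H]\<^bsup>2\<^esup>" if "e \<in> edges H" for e
    using edge[OF that] f(1) by (auto simp: nsets_def card_image inj_on_subset)
  then have simple: "simple_graph H'" by (auto simp: H'_def simple_graph_def)
  have "[f ` verts H]\<^bsup>2\<^esup> \<subseteq> [{1..n}]\<^bsup>2\<^esup>" using f(2) by (rule nsets_mono)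
  then have "subgraph H' (complete_graph n)"
    using simple f(2) by (auto simp: H'_def subgraph_def simple_graph_def complete_graph_def)
  moreover have "isomorphic H H'"
    unfolding isomorphic_def
  proof (intro exI conjI ballI)
    show "bij_betw f (verts H) (verts H')" using f(1) by (simp add: H'_def bij_betw_def)
    fix u v assume uv: "u \<in> verts H" "v \<in> verts H"
    \<comment> \<open>An edge of the image comes from some edge \<open>e\<close>; injectivity of
      \<open>f\<close> on the vertices forces \<open>e = {u, v}\<close>.\<close>
    have "{u, v} \<in> edges H" if "e \<in> edges H" "{f u, f v} = f ` e" for e
      using inj_on_image_eq_iff[OF f(1), of "{u, v}" e] edge(1)[OF that(1)] that uv by auto
    moreover have "{f u, f v} = f ` {u, v}" by simp
    ultimately show "{u, v} \<in> edges H \<longleftrightarrow> {f u, f v} \<in> edges H'"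
      unfolding H'_def graph.simps by blast
  qed
  moreover have "inj_on c (edges H')"
    using rainbow by (auto simp: H'_def inj_on_def)
  ultimately show ?thesis unfolding contains_rainbow_copy_def by blast
qed

section \<open>A large set with few colours at each vertex, and its edge count\<close>

lemma large_peel_layer:
  assumes V: "finite V" and empty: "peel c M V h = {}"
  obtains D where "D \<subseteq> V" "card V \<le> h * card D"
    "\<And>v. v \<in> D \<Longrightarrow> card (seen_colours c D v) < M"
proof (cases "h = 0")
  case True
  \<comment> \<open>Here \<open>V\<close> is itself the empty level 0.\<close>
  then show thesis using empty that[of "{}"] by simp
next
  case False
  define D where "D r = peel c M V r - peel c M V (Suc r)" for r
  have fin: "finite (peel c M V r)" for r
    using V peel_subset finite_subset by metis
  have telescope: "card V = (\<Sum>r<m. card (D r)) + card (peel c M V m)" for m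
  proof (induction m)
    case (Suc m)
    have sub: "peel c M V (Suc m) \<subseteq> peel c M V m" by (rule peel_antimono) simp
    have "card (peel c M V m) = card (D m) + card (peel c M V (Suc m))"
      unfolding D_def using card_Diff_subset[OF fin sub] card_mono[OF fin sub] by linarith
    with Suc show ?case by simp
  qed simp
  \<comment> \<open>Pigeonhole: as level \<open>h\<close> is empty, the \<open>h\<close> differences
    partition \<open>V\<close>.\<close>
  have "\<exists>r<h. card V \<le> h * card (D r)"
  proof (rule ccontr)
    assume "\<not> ?thesis"
    then have "(\<Sum>r<h. h * card (D r)) < (\<Sum>r<h. card V)"
      using False by (intro sum_strict_mono) auto
    then have "h * (\<Sum>r<h. card (D r)) < h * card V"
      by (simp add: sum_distrib_left)
    then show False using telescope[of h] empty by simp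
  qed
  then obtain r where r: "card V \<le> h * card (D r)" by blast
  have "card (seen_colours c (D r) v) < M" if "v \<in> D r" for v
  proof -
    have "card (seen_colours c (D r) v) \<le> card (seen_colours c (peel c M V r) v)"
      using fin by (intro card_mono seen_colours_mono) (auto simp: D_def seen_colours_def)
    also have "\<dots> < M" using that by (auto simp: D_def)
    finally show ?thesis .
  qed
  moreover have "D r \<subseteq> V" using peel_subset[of c M V r] by (auto simp: D_def)
  ultimately show thesis using that r by blast
qed

text \<open>The bound on a colour class is written as a square because the size of the class is
  compared with the geometric mean of two bounds, \<open>b\<^sup>2\<close> and the square of the
  number of vertices seeing the colour.\<close>

lemma few_local_colours_bound:
  fixes c :: "'a set \<Rightarrow> 'b" and b :: real
  assumes D: "finite D" and I: "finite I"
    and few: "\<And>v. v \<in> D \<Longrightarrow> card (seen_colours c D v) \<le> M"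
    and col: "\<And>x. x \<in> [D]\<^bsup>2\<^esup> \<Longrightarrow> c x \<in> I"
    and small: "\<And>i. i \<in> I \<Longrightarrow> card {x \<in> [D]\<^bsup>2\<^esup>. c x = i} \<le> b\<^sup>2" and b: "b \<ge> 0"
  shows "real (card D choose 2) \<le> b * (M * card D)"
proof -
  define E where "E i = {x \<in> [D]\<^bsup>2\<^esup>. c x = i}" for i
  define P where "P i = {v \<in> D. i \<in> seen_colours c D v}" for i
  have finP: "finite (P i)" for i using D by (simp add: P_def)
  have fin2: "finite ([D]\<^bsup>2\<^esup>)" using D by (rule finite_imp_finite_nsets)
  have E: "real (card (E i)) \<le> b * card (P i)" if i: "i \<in> I" for i
  proof -
    have "E i \<subseteq> (\<lambda>(u, v). {u, v}) ` (P i \<times> P i)"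
    proof
      fix x assume "x \<in> E i"
      then obtain u v where x: "x = {u, v}" "u \<in> D" "v \<in> D" "u \<noteq> v" "c {u, v} = i"
        by (auto simp: E_def nsets_2_eq)
      then have "c {v, u} = i" by (simp add: insert_commute)
      then have "i \<in> seen_colours c D u" "i \<in> seen_colours c D v"
        unfolding seen_colours_def
        using x by (intro image_eqI[of i _ v] image_eqI[of i _ u]; simp)+
      then have "u \<in> P i" "v \<in> P i" using x by (simp_all add: P_def)
      then show "x \<in> (\<lambda>(u, v). {u, v}) ` (P i \<times> P i)" using x(1) by auto
    qed
    then have "card (E i) \<le> card (P i \<times> P i)"
      using finP by (intro surj_card_le) auto
    then have "real (card (E i)) \<le> real (card (P i) * card (P i))"
      by (simp only: card_cartesian_product of_nat_le_iff)
    then have "sqrt (card (E i)) \<le> card (P i)"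
      by (intro real_le_lsqrt) (simp_all add: power2_eq_square)
    moreover have "sqrt (card (E i)) \<le> b"
      using small[OF i] b by (intro real_le_lsqrt) (simp_all add: E_def)
    ultimately have "sqrt (card (E i)) * sqrt (card (E i)) \<le> b * card (P i)"
      using b by (intro mult_mono) auto
    then show ?thesis by simp
  qed
  have "[D]\<^bsup>2\<^esup> = (\<Union>i\<in>I. E i)" using col by (auto simp: E_def)
  moreover have "card (\<Union>i\<in>I. E i) = (\<Sum>i\<in>I. card (E i))"
    using I fin2 by (intro card_UN_disjoint) (auto simp: E_def)
  ultimately have "card D choose 2 = (\<Sum>i\<in>I. card (E i))"
    using card_nsets[of D 2] by simp
  then have "real (card D choose 2) = (\<Sum>i\<in>I. real (card (E i)))"
    by (simp only: of_nat_sum)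
  also have "\<dots> \<le> (\<Sum>i\<in>I. b * card (P i))" by (intro sum_mono E)
  also have "\<dots> = b * real (\<Sum>i\<in>I. card (P i))" by (simp add: sum_distrib_left)
  \<comment> \<open>Double counting of pairs of a vertex and a colour it sees.\<close>
  also have "(\<Sum>i\<in>I. card (P i)) = (\<Sum>v\<in>D. card {i \<in> I. i \<in> seen_colours c D v})"
    unfolding P_def using I D by (rule sum_multicount_gen) simp
  also have "\<dots> \<le> (\<Sum>v\<in>D. M)"
  proof (rule sum_mono)
    fix v assume v: "v \<in> D"
    have "card {i \<in> I. i \<in> seen_colours c D v} \<le> card (seen_colours c D v)"
      using D by (intro card_mono) (auto simp: seen_colours_def)
    then show "card {i \<in> I. i \<in> seen_colours c D v} \<le> M" using few[OF v] by linarith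
  qed
  finally show ?thesis using b by (simp add: mult_left_mono mult.commute)
qed

section \<open>Balanced colourings and the choice of constants\<close>

lemma balanced_colouring_contains_rainbow_forest:
  fixes H :: "'a graph"
  assumes H: "finite_graph H" and F: "forest H"
    and h: "h = card (verts H)" and M: "M = Suc (card (edges H) + h)"
    and k: "k \<ge> Suc (32 * M\<^sup>2 * h\<^sup>2)" and n: "n \<ge> 2 * k"
    and c: "edge_colouring n k c" "colour_distribution n k c e"
    and e: "\<And>i. i \<in> {1..k} \<Longrightarrow> 2 * k * e i \<le> n\<^sup>2"
  shows "contains_rainbow_copy n c H"
proof (cases "peel c M {1..n} h = {}")
  case False
  have "degenerate 1 H" using forest_imp_degenerate_one[OF H F] .
  then obtain f where f: "inj_on f (verts H)" "f ` verts H \<subseteq> peel c M {1..n} (h - h)"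
      "inj_on (\<lambda>e. c (f ` e)) {e \<in> edges H. e \<subseteq> verts H}"
    using rainbow_embedding_of_peel[OF H _ _ _ False, of "verts H"] unfolding h M by auto
  have simple: "simple_graph H" using H by (simp add: finite_graph_def)
  then have "{e \<in> edges H. e \<subseteq> verts H} = edges H"
    by (auto simp: simple_graph_def nsets_def)
  then show ?thesis using contains_rainbow_copyI[OF simple f(1)] f by simp
next
  case True
  then obtain D where D: "D \<subseteq> {1..n}" "n \<le> h * card D"
      "\<And>v. v \<in> D \<Longrightarrow> card (seen_colours c D v) < M"
    using large_peel_layer[of "{1..n}" c M h] by auto
  have finD: "finite D" using D(1) finite_subset by blast
  have DK: "[D]\<^bsup>2\<^esup> \<subseteq> edges (complete_graph n)"
    using D(1) by (simp add: complete_graph_def nsets_mono)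
  have finK: "finite (edges (complete_graph n))"
    by (simp add: complete_graph_def finite_imp_finite_nsets)
  have k0: "k > 0" using k by simp
  \<comment> \<open>Chosen so that \<open>b\<^sup>2\<close> is the bound on \<open>e i\<close> given
    by the hypothesis.\<close>
  define b where "b = n / sqrt (2 * k)"
  have b: "b \<ge> 0" "b\<^sup>2 = n\<^sup>2 / (2 * k)" by (simp_all add: b_def power_divide)
  have "card {x \<in> [D]\<^bsup>2\<^esup>. c x = i} \<le> b\<^sup>2" if i: "i \<in> {1..k}" for i
  proof -
    have "card {x \<in> [D]\<^bsup>2\<^esup>. c x = i} \<le> card {x \<in> edges (complete_graph n). c x = i}"
      using finK DK by (intro card_mono) auto
    also have "\<dots> = e i" using c(2) i by (simp add: colour_distribution_def)
    finally have "2 * k * card {x \<in> [D]\<^bsup>2\<^esup>. c x = i} \<le> n\<^sup>2"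
      using e[OF i] by (meson le_trans mult_le_mono2)
    then have "real (2 * k * card {x \<in> [D]\<^bsup>2\<^esup>. c x = i}) \<le> real (n\<^sup>2)"
      by (simp only: of_nat_le_iff)
    then show ?thesis using k0 by (simp add: b field_simps)
  qed
  moreover have "c x \<in> {1..k}" if "x \<in> [D]\<^bsup>2\<^esup>" for x
    using c(1) DK that by (auto simp: edge_colouring_def)
  ultimately have "real (card D choose 2) \<le> b * (M * card D)"
    using few_local_colours_bound[OF finD, of "{1..k}" c M b] D(3) b(1)
    by (simp add: less_imp_le)
  moreover have n0: "n > 0" using k0 n by simp
  then have h0: "h > 0" and s0: "card D > 0" using D(2) by (auto intro!: Nat.gr0I)
  have "real (card D choose 2) = card D * (real (card D) - 1) / 2"
    using s0 by (simp add: choose_two real_of_nat_div)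
  ultimately have "card D * (real (card D) - 1) \<le> card D * (2 * b * M)"
    by (simp add: algebra_simps)
  then have "real (card D) - 1 \<le> 2 * b * M"
    using s0 by (simp add: mult_le_cancel_left_pos)
  then have "h * (real (card D) - 1) \<le> h * (2 * b * M)" by (intro mult_left_mono) auto
  \<comment> \<open>This is where the constant 32 comes from: \<open>2 * k\<close> is at least the
    square of \<open>8 * M * h\<close>.\<close>
  moreover have "h * b * M \<le> n / 8"
  proof -
    have "real (64 * M\<^sup>2 * h\<^sup>2) \<le> real (2 * k)"
      using k by (simp only: of_nat_le_iff)
    then have "8 * real M * h \<le> sqrt (2 * k)"
      by (intro real_le_rsqrt) (simp add: power_mult_distrib)
    then have "n * (8 * real M * h) \<le> n * sqrt (2 * k)" by (intro mult_left_mono) auto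
    then show ?thesis using k0 by (simp add: b_def field_simps)
  qed
  moreover have "real n \<le> h * real (card D)"
    using D(2) by (simp only: of_nat_mult[symmetric] of_nat_le_iff)
  moreover have "2 * h \<le> n"
  proof -
    have "h * 1 \<le> h * (32 * M\<^sup>2 * h)" using M h0 by (intro mult_le_mono2) simp
    also have "\<dots> = 32 * M\<^sup>2 * h\<^sup>2" by (simp add: power2_eq_square)
    finally show ?thesis using k n by linarith
  qed
  then have "2 * real h \<le> n" by linarith
  \<comment> \<open>With d = \<open>card D\<close>, the bounds give n - h \<le> h (d - 1) \<le> n/4,
    while h \<le> n/2; hence n \<le> 3n/4.\<close>
  ultimately have "real n \<le> 0" by (simp add: algebra_simps)
  then show ?thesis using n0 by simp
qed

theorem theorem1p7:
  fixes H :: "'a graph"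
  assumes "finite_graph H" and "forest H"
  shows "\<exists>K. \<forall>k\<ge>K. g H k = \<infinity>"
proof -
  define h where "h = card (verts H)"
  define M where "M = Suc (card (edges H) + h)"
  have "\<not> all_distributions_from H k N" if k: "k \<ge> Suc (32 * M\<^sup>2 * h\<^sup>2)" for k N
  proof
    assume all: "all_distributions_from H k N"
    \<comment> \<open>This choice makes \<open>n choose 2\<close> divisible by \<open>k\<close>, so
      all colours can be equally frequent, and also gives \<open>n\<close> at least \<open>N\<close>
      and \<open>2 * k\<close>.\<close>
    define n where "n = 2 * k * Suc N"
    define e :: "nat \<Rightarrow> nat" where "e i = Suc N * (n - 1)" for i
    have "1 * Suc N \<le> n" unfolding n_def using k by (intro mult_le_mono1) linarith
    then have "N \<le> n" "2 * k \<le> n" by (simp_all add: n_def)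
    have "n choose 2 = k * Suc N * (n - 1)"
      by (simp add: choose_two n_def del: mult_Suc_right)
    then have "(\<Sum>i=1..k. e i) = n choose 2" by (simp add: e_def mult.assoc del: mult_Suc mult_Suc_right)
    then obtain c where c: "edge_colouring n k c" "colour_distribution n k c e"
        and free: "\<not> contains_rainbow_copy n c H"
      using all \<open>N \<le> n\<close> unfolding all_distributions_from_def by blast
    have "2 * k * e i = n * (n - 1)" for i by (simp add: e_def n_def mult.assoc del: mult_Suc mult_Suc_right)
    then have "2 * k * e i \<le> n\<^sup>2" for i by (simp add: power2_eq_square)
    then show False
      using balanced_colouring_contains_rainbow_forest[OF assms h_def M_def k \<open>2 * k \<le> n\<close> c] free
      by blast
  qed
  then show ?thesis by (auto simp: g_eq_infinity_iff)
qed

end
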